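(* Let $u=(u_i)_{i\in\mathbb Z}$ be a real sequence with only finitely many nonzero terms such that $v_{\sup}=\sup_i(u_i+u_{i+1})\le 1$ (case (C1)), and let $k=v_{\sup}$. Then any fundamental eigenpair $(\Phi^{(1)},\Phi^{(2)})$ (i.e. any pair of fundamental eigenvectors of $A(\gamma)$ and $A(\delta)$ associated with a soliton of $u$) satisfies, for a suitable value of the parameter $\sigma\in\mathbb R$, for all $i\in\mathbb Z$: $$\Phi^{(1)}_i=\max\bigl(\Phi^{(2)}_{i+1},\ \Phi^{(1)}_{i+1}+u_i-1\bigr),\qquad \Phi^{(2)}_{i+1}=\max\bigl(\Phi^{(1)}_i-\sigma,\ \Phi^{(2)}_i+u_i+k-1\bigr).$$
   Context: Max-plus conventions: on $\mathbb R\cup\{-\infty\}$, $a\oplus b=\max(a,b)$, $a\otimes b=a+b$, extended to matrices and vectors in the usual way. Put $\gamma_i=\min(u_i,1-u_{i-1})$ and $\delta_i=\min(u_{i-1},1-u_i)$. The $\mathbb Z\times\mathbb Z$ matrix $A(\gamma)$ has entries $A(\gamma)_{i,i+1}=\gamma_i-k$, $A(\gamma)_{i,i-1}=\gamma_i$, and all other entries $-\infty$; $A(\delta)$ is defined in the same way with $\delta_i$ in place of $\gamma_i$. Soliton in case (C1) (with $s\ge1$): a sequence of indices $(l,l+1,\ldots,l+s)$ such that $u_l+u_{l+1}=\cdots=u_{l+s-1}+u_{l+s}=v_{\sup}$ while $u_{l-1}+u_l<v_{\sup}$ and $u_{l+s}+u_{l+s+1}<v_{\sup}$. For $A$ equal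 to $A(\gamma)$ or $A(\delta)$, the Kleene star is $A^*=I\oplus A\oplus A^2\oplus\cdots$ ($I$ has $0$ on the diagonal and $-\infty$ elsewhere); $A^*_{ij}$, $i\neq j$, is the greatest weight (sum of entries) of a path from $i$ to $j$ in the digraph on $\mathbb Z$ with edges $(i,j)$, $A_{ij}\ne-\infty$. The critical graph of $A$ consists of the nodes and edges of the two-cycles of greatest total weight. The fundamental eigenpair associated with the soliton $(l,\ldots,l+s)$ consists of columns of the Kleene stars indexed by nodes of the corresponding strongly connected components of the critical graphs: $\Phi^{(1)}$ is column $l$ of $A(\gamma)^*$ and $\Phi^{(2)}$ is column $l+s$ of $A(\delta)^*$ (other columns of the same components differ only by additive constants), each shifted by an additive constant so that $\Phi^{(1)}_i=\Phi^{(2)}_i=0$ for all sufficiently large $i$. *)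

theory Defs
  imports "HOL-Library.Extended_Real"
begin

text \<open>
  Max-plus scalars are elements of \<^typ>\<open>ereal\<close>, with \<open>max\<close> (suprema, for infinite max-plus sums)
  as addition and \<open>+\<close> as multiplication; \<open>-\<infinity>\<close> is the max-plus zero.  The value \<open>\<infinity>\<close> never
  occurs as an entry of the matrices below.
\<close>

type_synonym mp_matrix = "int \<Rightarrow> int \<Rightarrow> ereal"

definition mp_one :: mp_matrix where
  "mp_one i j = (if i = j then 0 else -\<infinity>)"

definition mp_mult :: "mp_matrix \<Rightarrow> mp_matrix \<Rightarrow> mp_matrix" where
  "mp_mult A B i j = (SUP m. A i m + B m j)"

primrec mp_power :: "mp_matrix \<Rightarrow> nat \<Rightarrow> mp_matrix" where
  "mp_power A 0 = mp_one"
| "mp_power A (Suc n) = mp_mult A (mp_power A n)"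

definition kleene_star :: "mp_matrix \<Rightarrow> mp_matrix" where
  "kleene_star A i j = (SUP n. mp_power A n i j)"

definition two_cycle :: "mp_matrix \<Rightarrow> int \<Rightarrow> int \<Rightarrow> bool" where
  "two_cycle A i j \<longleftrightarrow> i \<noteq> j \<and> A i j \<noteq> -\<infinity> \<and> A j i \<noteq> -\<infinity>"

text \<open>
  The critical graph, given by its edge set; its nodes are the \<^const>\<open>Field\<close> of that set.
\<close>

definition critical_graph :: "mp_matrix \<Rightarrow> (int \<times> int) set" where
  "critical_graph A = {(i, j). two_cycle A i j \<and>
     (\<forall>i' j'. two_cycle A i' j' \<longrightarrow> A i' j' + A j' i' \<le> A i j + A j i)}"

definition critical_component :: "mp_matrix \<Rightarrow> int \<Rightarrow> int set" where
  "critical_component A p = {q \<in> Field (critical_graph A).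
     (p, q) \<in> (critical_graph A)\<^sup>* \<and> (q, p) \<in> (critical_graph A)\<^sup>*}"

text \<open>
  The column may be indexed by any node of the component of \<open>p\<close>; the additive constant \<open>c\<close> is
  pinned down by the normalisation at \<open>+\<infinity>\<close>.
\<close>

definition fundamental_eigenvector :: "mp_matrix \<Rightarrow> int \<Rightarrow> (int \<Rightarrow> ereal) \<Rightarrow> bool" where
  "fundamental_eigenvector A p \<Phi> \<longleftrightarrow>
     (\<exists>q \<in> critical_component A p. \<exists>c::real. \<forall>i. \<Phi> i = kleene_star A i q + ereal c) \<and>
     (\<exists>N. \<forall>i\<ge>N. \<Phi> i = 0)"

definition v_sup :: "(int \<Rightarrow> real) \<Rightarrow> real" where
  "v_sup u = (SUP i. u i + u (i + 1))"

definition gam :: "(int \<Rightarrow> real) \<Rightarrow> int \<Rightarrow> real" where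
  "gam u i = min (u i) (1 - u (i - 1))"

definition del :: "(int \<Rightarrow> real) \<Rightarrow> int \<Rightarrow> real" where
  "del u i = min (u (i - 1)) (1 - u i)"

definition mp_A :: "real \<Rightarrow> (int \<Rightarrow> real) \<Rightarrow> mp_matrix" where
  "mp_A k w i j =
     (if j = i + 1 then ereal (w i - k) else if j = i - 1 then ereal (w i) else -\<infinity>)"

definition soliton :: "(int \<Rightarrow> real) \<Rightarrow> int \<Rightarrow> int \<Rightarrow> bool" where
  "soliton u l s \<longleftrightarrow> 1 \<le> s \<and>
     (\<forall>i. l \<le> i \<and> i < l + s \<longrightarrow> u i + u (i + 1) = v_sup u) \<and>
     u (l - 1) + u l < v_sup u \<and> u (l + s) + u (l + s + 1) < v_sup u"

definition fundamental_eigenpair ::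
  "(int \<Rightarrow> real) \<Rightarrow> real \<Rightarrow> (int \<Rightarrow> ereal) \<Rightarrow> (int \<Rightarrow> ereal) \<Rightarrow> bool" where
  "fundamental_eigenpair u k \<Phi>1 \<Phi>2 \<longleftrightarrow>
     (\<exists>l s. soliton u l s \<and>
        fundamental_eigenvector (mp_A k (gam u)) l \<Phi>1 \<and>
        fundamental_eigenvector (mp_A k (del u)) (l + s) \<Phi>2)"

end

theory Submission imports Defs begin

text \<open>
  In case (C1) one has \<open>gam u i = u i\<close> and \<open>del u i = u (i - 1)\<close>, so \<open>A(\<delta>)\<close> is \<open>A(\<gamma>)\<close> with both
  indices shifted by one.  A soliton attains \<open>v_sup u = k\<close>, so the critical two-cycles have weight
  zero, and along such a cycle the columns of the Kleene star differ by a finite constant.  The two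
  fundamental eigenvectors are therefore constant shifts of the same column, and the normalisation
  gives \<open>\<Phi>2 (i + 1) = \<Phi>1 i\<close>.  With \<open>\<sigma> = 0\<close> both equations reduce to \<open>A A\<^sup>* \<le> A\<^sup>*\<close> and \<open>k \<le> 1\<close>.
\<close>

lemma mp_power_Suc_left:
  assumes "A i m = ereal a"
  shows "ereal a + mp_power A n m j \<le> mp_power A (Suc n) i j"
  using SUP_upper[of m UNIV "\<lambda>m. A i m + mp_power A n m j"] assms
  by (simp add: mp_mult_def)

text \<open>Powers are built by multiplying on the left, so appending an edge at the end of a path
  takes an induction that carries this edge through the recursion.\<close>

lemma mp_power_Suc_right:
  assumes "A m j = ereal a"
  shows "mp_power A n i m + ereal a \<le> mp_power A (Suc n) i j"
proof (induction n arbitrary: i)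
  case 0
  show ?case
    using mp_power_Suc_left[of A m j a 0 j, OF assms] by (simp add: mp_one_def)
next
  case (Suc n)
  \<comment> \<open>Since \<open>a\<close> is finite, it can be moved to the right-hand side; what
    remains on the left is a single term of the supremum over \<open>r\<close>.\<close>
  have "A i r + mp_power A n r m \<le> mp_power A (Suc (Suc n)) i j - ereal a" for r
  proof -
    have "A i r + mp_power A n r m + ereal a \<le> A i r + mp_power A (Suc n) r j"
      using Suc.IH[of r] by (simp add: add.assoc add_left_mono del: mp_power.simps)
    also have "\<dots> \<le> mp_power A (Suc (Suc n)) i j"
      unfolding mp_power.simps(2)[of A "Suc n"] mp_mult_def by (rule SUP_upper) simp
    finally show ?thesis
      by (simp add: ereal_le_minus)
  qed
  then have "mp_power A (Suc n) i m \<le> mp_power A (Suc (Suc n)) i j - ereal a"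
    unfolding mp_power.simps(2)[of A n] mp_mult_def[of A "mp_power A n"] by (intro SUP_least)
  then show ?case
    by (simp add: ereal_le_minus del: mp_power.simps)
qed

lemma mp_power_le_kleene_star: "mp_power A n i j \<le> kleene_star A i j"
  unfolding kleene_star_def by (rule SUP_upper) simp

lemma kleene_star_left:
  assumes "A i m = ereal a"
  shows "ereal a + kleene_star A m j \<le> kleene_star A i j"
proof -
  have "mp_power A n m j \<le> kleene_star A i j - ereal a" for n
    using order_trans[OF mp_power_Suc_left[where n = n] mp_power_le_kleene_star, of A, OF assms]
    by (simp add: ereal_le_minus add.commute)
  then have "kleene_star A m j \<le> kleene_star A i j - ereal a"
    unfolding kleene_star_def[of A m] by (intro SUP_least)
  then show ?thesis
    by (simp add: ereal_le_minus add.commute)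
qed

lemma kleene_star_right:
  assumes "A m j = ereal a"
  shows "kleene_star A i m + ereal a \<le> kleene_star A i j"
proof -
  have "mp_power A n i m \<le> kleene_star A i j - ereal a" for n
    using order_trans[OF mp_power_Suc_right[where n = n] mp_power_le_kleene_star, of A, OF assms]
    by (simp add: ereal_le_minus)
  then have "kleene_star A i m \<le> kleene_star A i j - ereal a"
    unfolding kleene_star_def[of A i m] by (intro SUP_least)
  then show ?thesis
    by (simp add: ereal_le_minus)
qed

text \<open>Maximality among two-cycles is left out on purpose: the links inside a soliton then
  qualify by direct computation, and only the cancelling weights matter for comparing
  columns.\<close>

definition zero_cycles :: "mp_matrix \<Rightarrow> (int \<times> int) set" where
  "zero_cycles A = {(p, q). \<exists>a. A p q = ereal a \<and> A q p = ereal (- a)}"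

text \<open>Appending the edge from \<open>p\<close> to \<open>q\<close> bounds column
  \<open>q\<close> from below, and appending the return edge bounds it from above by the same
  quantity.\<close>

lemma kleene_star_zero_cycle:
  assumes "(p, q) \<in> zero_cycles A"
  shows "\<exists>a. \<forall>i. kleene_star A i q = kleene_star A i p + ereal a"
proof -
  obtain a where a: "A p q = ereal a" "A q p = ereal (- a)"
    using assms by (auto simp: zero_cycles_def)
  have "kleene_star A i q = kleene_star A i p + ereal a" for i
    using kleene_star_right[of A p q a i, OF a(1)] kleene_star_right[of A q p "- a" i, OF a(2)]
    by (cases "kleene_star A i q"; cases "kleene_star A i p") auto
  then show ?thesis
    by blast
qed

lemma kleene_star_zero_cycles_rtrancl:
  assumes "(p, q) \<in> (zero_cycles A)\<^sup>*"
  shows "\<exists>a. \<forall>i. kleene_star A i q = kleene_star A i p + ereal a"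
  using assms
proof induction
  case base
  show ?case
    by (rule exI[of _ 0]) simp
next
  case (step q r)
  obtain a where a: "\<And>i. kleene_star A i q = kleene_star A i p + ereal a"
    using step.IH by blast
  obtain b where "\<And>i. kleene_star A i r = kleene_star A i q + ereal b"
    using kleene_star_zero_cycle[OF step.hyps(2)] by blast
  then have "\<forall>i. kleene_star A i r = kleene_star A i p + ereal (a + b)"
    by (simp add: a add.assoc)
  then show ?case ..
qed

lemma kleene_star_shift:
  assumes "\<And>i j. B (i + 1) (j + 1) = A i j"
  shows "kleene_star B (i + 1) (j + 1) = kleene_star A i j"
proof -
  \<comment> \<open>Translation by one is a bijection of the integers, so the supremum over the
    intermediate node in a product is unchanged by this reindexing.\<close>
  have range: "range f = range (\<lambda>m. f (m + 1))" for f :: "int \<Rightarrow> ereal"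
    by (auto intro: rev_image_eqI[of "x - 1" for x])
  have "mp_power B n (i + 1) (j + 1) = mp_power A n i j" for n
  proof (induction n arbitrary: i)
    case 0
    show ?case
      by (simp add: mp_one_def)
  next
    case (Suc n)
    show ?case
      using range[of "\<lambda>m. B (i + 1) m + mp_power B n m (j + 1)"]
      by (simp add: mp_mult_def assms Suc.IH)
  qed
  then show ?thesis
    by (simp add: kleene_star_def)
qed

text \<open>Two-cycles join neighbours only, and the one on \<open>i\<close> and
  \<open>i + 1\<close> weighs \<open>w i + w (i + 1) - k\<close>. This is never positive and
  vanishes at \<open>p\<close>, so the greatest weight is zero.\<close>

lemma critical_graph_mp_A_zero_cycles:
  assumes le: "\<And>i. w i + w (i + 1) \<le> k" and eq: "w p + w (p + 1) = k"
  shows "critical_graph (mp_A k w) \<subseteq> zero_cycles (mp_A k w)"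
proof clarify
  fix i j
  assume ij: "(i, j) \<in> critical_graph (mp_A k w)"
  have "two_cycle (mp_A k w) p (p + 1)"
    by (simp add: two_cycle_def mp_A_def)
  then have ge: "mp_A k w p (p + 1) + mp_A k w (p + 1) p \<le> mp_A k w i j + mp_A k w j i"
    using ij by (simp add: critical_graph_def)
  have "j = i + 1 \<or> j = i - 1"
    using ij by (auto simp: critical_graph_def two_cycle_def mp_A_def split: if_splits)
  then show "(i, j) \<in> zero_cycles (mp_A k w)"
    using ge eq le[of i] le[of "i - 1"] by (auto simp: zero_cycles_def mp_A_def)
qed

text \<open>A supremum of reals is an upper bound once its set is bounded above; finite support
  leaves only finitely many sums.\<close>

lemma v_sup_upper:
  assumes "finite {i. u i \<noteq> 0}"
  shows "u i + u (i + 1) \<le> v_sup u"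
proof -
  have "range u \<subseteq> insert 0 (u ` {i. u i \<noteq> 0})"
    by auto
  then have "finite (range u)"
    by (rule finite_subset) (simp add: assms)
  then have "finite ((\<lambda>(a, b). a + b) ` (range u \<times> range u))"
    by simp
  then have "finite (range (\<lambda>i. u i + u (i + 1)))"
    by (rule rev_finite_subset) auto
  then show ?thesis
    unfolding v_sup_def by (intro cSUP_upper bdd_above_finite) auto
qed

theorem proposition3p1:
  fixes u :: "int \<Rightarrow> real" and k :: real and \<Phi>1 \<Phi>2 :: "int \<Rightarrow> ereal"
  assumes "finite {i. u i \<noteq> 0}"
    and "v_sup u \<le> 1"
    and "k = v_sup u"
    and "fundamental_eigenpair u k \<Phi>1 \<Phi>2"
  shows "\<exists>\<sigma>::real. \<forall>i.
      \<Phi>1 i = max (\<Phi>2 (i + 1)) (\<Phi>1 (i + 1) + ereal (u i - 1)) \<and>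
      \<Phi>2 (i + 1) = max (\<Phi>1 i - ereal \<sigma>) (\<Phi>2 i + ereal (u i + k - 1))"
proof -
  have le: "u i + u (i + 1) \<le> k" for i
    using v_sup_upper[OF assms(1)] assms(3) by simp
  have le': "u (i - 1) + u i \<le> k" for i
    using le[of "i - 1"] by simp
  have k1: "k \<le> 1"
    using assms(2,3) by simp
  have gam: "gam u = u"
  proof
    fix i
    show "gam u i = u i"
      using le'[of i] k1 by (simp add: gam_def)
  qed
  have del: "del u = (\<lambda>i. u (i - 1))"
  proof
    fix i
    show "del u i = u (i - 1)"
      using le'[of i] k1 by (simp add: del_def)
  qed
  define A where "A = mp_A k u"
  define B where "B = mp_A k (\<lambda>i. u (i - 1))"
  obtain l s where s: "1 \<le> s" and sol: "\<And>i. l \<le> i \<Longrightarrow> i < l + s \<Longrightarrow> u i + u (i + 1) = k"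
    and \<Phi>1: "fundamental_eigenvector A l \<Phi>1"
    and \<Phi>2: "fundamental_eigenvector B (l + s) \<Phi>2"
    using assms(3,4) by (auto simp: fundamental_eigenpair_def soliton_def gam del A_def B_def)
  have shift: "kleene_star B (i + 1) (j + 1) = kleene_star A i j" for i j
    by (rule kleene_star_shift) (simp add: A_def B_def mp_A_def)
  have critA: "critical_graph A \<subseteq> zero_cycles A"
    unfolding A_def using le sol[of l] s by (intro critical_graph_mp_A_zero_cycles) auto
  have critB: "critical_graph B \<subseteq> zero_cycles B"
    unfolding B_def using le' sol[of l] s
    \<comment> \<open>The weights of \<open>B\<close> are delayed by one, so the soliton's first sum
      \<open>u l + u (l + 1)\<close> appears at \<open>l + 1\<close>.\<close>
    by (intro critical_graph_mp_A_zero_cycles[where p = "l + 1"]) (auto simp: add.commute)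
  have colA: "\<exists>c. \<forall>i. \<Phi>1 i = kleene_star A i l + ereal c"
  proof -
    obtain q c where q: "(l, q) \<in> (critical_graph A)\<^sup>*"
      and c: "\<And>i. \<Phi>1 i = kleene_star A i q + ereal c"
      using \<Phi>1 by (auto simp: fundamental_eigenvector_def critical_component_def)
    obtain a where "\<And>i. kleene_star A i q = kleene_star A i l + ereal a"
      using kleene_star_zero_cycles_rtrancl rtrancl_mono[OF critA] q by blast
    then have "\<forall>i. \<Phi>1 i = kleene_star A i l + ereal (a + c)"
      by (simp add: c add.assoc)
    then show ?thesis ..
  qed
  have colB: "\<exists>c. \<forall>i. \<Phi>2 (i + 1) = kleene_star A i l + ereal c"
  proof -
    obtain q c where q: "(l + s, q) \<in> (critical_graph B)\<^sup>*"
      and c: "\<And>i. \<Phi>2 i = kleene_star B i q + ereal c"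
      using \<Phi>2 by (auto simp: fundamental_eigenvector_def critical_component_def)
    obtain a where a: "\<And>i. kleene_star B i q = kleene_star B i (l + s) + ereal a"
      using kleene_star_zero_cycles_rtrancl rtrancl_mono[OF critB] q by blast
    \<comment> \<open>Column \<open>l + s\<close> of \<open>B\<close> is the shifted column
      \<open>l + s - 1\<close> of \<open>A\<close>. Zero cycles between consecutive soliton nodes
      link the latter to column \<open>l\<close>.\<close>
    have "j < l + s \<longrightarrow> (l, j) \<in> (zero_cycles A)\<^sup>*" if "l \<le> j" for j
      using that
    proof (induction j rule: int_ge_induct)
      case (step j)
      have "(j, j + 1) \<in> zero_cycles A" if "j < l + s"
        using sol[OF step.hyps that] by (auto simp: zero_cycles_def A_def mp_A_def)
      with step.IH show ?case
        by (auto intro: rtrancl_into_rtrancl)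
    qed simp
    then have "(l, l + s - 1) \<in> (zero_cycles A)\<^sup>*"
      using s by simp
    then obtain b where b: "\<And>i. kleene_star A i (l + s - 1) = kleene_star A i l + ereal b"
      using kleene_star_zero_cycles_rtrancl by blast
    have "\<forall>i. \<Phi>2 (i + 1) = kleene_star A i l + ereal (b + a + c)"
      using shift[of _ "l + s - 1"] by (simp add: c a b add.assoc)
    then show ?thesis ..
  qed
  obtain c d where c: "\<And>i. \<Phi>1 i = kleene_star A i l + ereal c"
    and d: "\<And>i. \<Phi>2 (i + 1) = kleene_star A i l + ereal d"
    using colA colB by blast
  obtain N M where N: "\<And>i. N \<le> i \<Longrightarrow> \<Phi>1 i = 0" and M: "\<And>i. M \<le> i \<Longrightarrow> \<Phi>2 i = 0"
    using \<Phi>1 \<Phi>2 by (auto simp: fundamental_eigenvector_def)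
  \<comment> \<open>At this index both normalised vectors vanish, which also forces the Kleene star
    entry to be finite and hence cancellable.\<close>
  have "c = d"
    using c[of "max N M"] d[of "max N M"] N[of "max N M"] M[of "max N M + 1"]
    by (cases "kleene_star A (max N M) l") (auto simp: zero_ereal_def)
  then have \<Phi>12: "\<Phi>2 (i + 1) = \<Phi>1 i" for i
    by (simp add: c d)
  have \<Phi>2': "\<Phi>2 i = \<Phi>1 (i - 1)" for i
    using \<Phi>12[of "i - 1"] by simp
  \<comment> \<open>The slack \<open>b \<le> a\<close> absorbs the gap \<open>1 - k\<close> between
    the coefficients of the two equations and the entries of \<open>A\<close>.\<close>
  have sub: "\<Phi>1 m + ereal b \<le> \<Phi>1 i" if "A i m = ereal a" "b \<le> a" for i m a b
  proof -
    have "\<Phi>1 m + ereal b \<le> (ereal a + kleene_star A m l) + ereal c"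
      using that(2) by (cases "kleene_star A m l") (auto simp: c)
    also have "\<dots> \<le> \<Phi>1 i"
      unfolding c by (intro add_right_mono kleene_star_left that(1))
    finally show ?thesis .
  qed
  have up: "\<Phi>1 (i + 1) + ereal (u i - 1) \<le> \<Phi>1 i" for i
    by (rule sub[where a = "u i - k"]) (use k1 in \<open>auto simp: A_def mp_A_def\<close>)
  have down: "\<Phi>1 (i - 1) + ereal (u i + k - 1) \<le> \<Phi>1 i" for i
    by (rule sub[where a = "u i"]) (use k1 in \<open>auto simp: A_def mp_A_def\<close>)
  show ?thesis
    \<comment> \<open>In each maximum the first argument already equals \<Phi>1 at \<open>i\<close>;
      \<open>up\<close> and \<open>down\<close> say that the second never exceeds it.\<close>
    by (rule exI[of _ 0]) (use up down in \<open>simp add: \<Phi>2' max_absorb1\<close>)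
qed

end
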